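(* Let $R$ be a commutative ring with non-zero identity, let $M$ be a unitary $R$-module and let $N$ be a proper submodule of $M$. Then the following statements are equivalent: (1) $N$ is a 1-absorbing primary submodule of $M$. (2) If $a,b$ are non-unit elements of $R$ such that $ab\notin (N:_R M)$, then $(N:_M ab)\subseteq M\text{-}\mathrm{rad}(N)$. (3) If $a,b$ are non-unit elements of $R$, and $K$ is a submodule of $M$ with $abK\subseteq N$, then $ab\in (N:_R M)$ or $K\subseteq M\text{-}\mathrm{rad}(N)$. (4) Whenever $I_1I_2K\subseteq N$ for some proper ideals $I_1,I_2$ of $R$ and some submodule $K$ of $M$, then either $I_1I_2\subseteq (N:_R M)$ or $K\subseteq M\text{-}\mathrm{rad}(N)$.
   Context: All rings are commutative with non-zero identity and all modules are unitary. For a submodule $N$ of an $R$-module $M$: $(N:_R M)=\{r\in R: rM\subseteq N\}$, and for $r\in R$, $(N:_M r)=\{m\in M: rm\in N\}$. A proper submodule $P$ of $M$ is prime if for $a\in R$, $m\in M$, $am\in P$ implies $m\in P$ or $a\in (P:_R M)$. $M\text{-}\mathrm{rad}(N)$ is the intersection of all prime submodules of $M$ containing $N$, and $M\text{-}\mathrm{rad}(N)=M$ if there is no such prime submodule. A proper submodule $N$ of $M$ is a 1-absorbing primary submodule if whenever $a,b\in R$ are non-unit elements and $m\in M$ with $abm\in N$, then $ab\in (N:_R M)$ or $m\in M\text{-}\mathrm{rad}(N)$. *)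

theory Defs
  imports "HOL-Algebra.Module" "HOL-Algebra.Ideal_Product"
begin

definition module_colon ::
    "('a, 'r) ring_scheme \<Rightarrow> ('a, 'b, 'm) module_scheme \<Rightarrow> 'b set \<Rightarrow> 'a set"
  where "module_colon R M N = {r \<in> carrier R. \<forall>m \<in> carrier M. r \<odot>\<^bsub>M\<^esub> m \<in> N}"

definition element_colon ::
    "('a, 'b, 'm) module_scheme \<Rightarrow> 'b set \<Rightarrow> 'a \<Rightarrow> 'b set"
  where "element_colon M N r = {m \<in> carrier M. r \<odot>\<^bsub>M\<^esub> m \<in> N}"

definition proper_submodule ::
    "('a, 'r) ring_scheme \<Rightarrow> ('a, 'b, 'm) module_scheme \<Rightarrow> 'b set \<Rightarrow> bool"
  where "proper_submodule R M N \<longleftrightarrow> submodule N R M \<and> N \<noteq> carrier M"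

definition prime_submodule ::
    "('a, 'r) ring_scheme \<Rightarrow> ('a, 'b, 'm) module_scheme \<Rightarrow> 'b set \<Rightarrow> bool"
  where "prime_submodule R M P \<longleftrightarrow> proper_submodule R M P \<and>
    (\<forall>a \<in> carrier R. \<forall>m \<in> carrier M.
       a \<odot>\<^bsub>M\<^esub> m \<in> P \<longrightarrow> m \<in> P \<or> a \<in> module_colon R M P)"

definition module_rad ::
    "('a, 'r) ring_scheme \<Rightarrow> ('a, 'b, 'm) module_scheme \<Rightarrow> 'b set \<Rightarrow> 'b set"
  where "module_rad R M N =
    (if \<exists>P. prime_submodule R M P \<and> N \<subseteq> P
     then \<Inter> {P. prime_submodule R M P \<and> N \<subseteq> P}
     else carrier M)"

definition one_absorbing_primary_submodule ::
    "('a, 'r) ring_scheme \<Rightarrow> ('a, 'b, 'm) module_scheme \<Rightarrow> 'b set \<Rightarrow> bool"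
  where "one_absorbing_primary_submodule R M N \<longleftrightarrow> proper_submodule R M N \<and>
    (\<forall>a \<in> carrier R - Units R. \<forall>b \<in> carrier R - Units R. \<forall>m \<in> carrier M.
       (a \<otimes>\<^bsub>R\<^esub> b) \<odot>\<^bsub>M\<^esub> m \<in> N \<longrightarrow>
         a \<otimes>\<^bsub>R\<^esub> b \<in> module_colon R M N \<or> m \<in> module_rad R M N)"

text \<open>
  The product \<open>I K\<close> consists of all finite sums of elements \<open>i k\<close>. As in \<^const>\<open>ideal_prod\<close>,
  closure under sums suffices: for an ideal \<open>I\<close> and a submodule \<open>K\<close>, zero, negatives and scalar
  multiples are obtained from the generators.
\<close>
inductive_set ideal_module_prod ::
    "('a, 'b, 'm) module_scheme \<Rightarrow> 'a set \<Rightarrow> 'b set \<Rightarrow> 'b set"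
  for M and I and K where
    smult: "\<lbrakk> i \<in> I; k \<in> K \<rbrakk> \<Longrightarrow> i \<odot>\<^bsub>M\<^esub> k \<in> ideal_module_prod M I K"
  | sum: "\<lbrakk> x \<in> ideal_module_prod M I K; y \<in> ideal_module_prod M I K \<rbrakk>
      \<Longrightarrow> x \<oplus>\<^bsub>M\<^esub> y \<in> ideal_module_prod M I K"

end

theory Submission
  imports Defs
begin

text \<open>
  All four conditions constrain how products \<open>a \<otimes> b\<close> of non-units act, and they differ only in
  whether elements or the ideals and submodules containing them are quantified over. Passing from
  elements to sets uses two observations. First, the failure of \<open>I\<^sub>1 I\<^sub>2 \<subseteq> (N : M)\<close> is always
  witnessed by a single product \<open>a \<otimes> b\<close> with \<open>a \<in> I\<^sub>1\<close> and \<open>b \<in> I\<^sub>2\<close>, since \<open>(N : M)\<close> is closed under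
  sums (\<open>module_colon_add_closed\<close>); here \<open>a\<close> and \<open>b\<close> are non-units because the ideals are proper.
  Second, once such a pair is fixed, the elementwise condition applies to each \<open>k \<in> K\<close> separately
  and puts all of \<open>K\<close> into the radical.

  Passing back from sets to elements, replace \<open>a\<close>, \<open>b\<close> and \<open>m\<close> by the principal ideals and the cyclic
  submodule \<open>R m\<close> that they generate. A principal ideal of a non-unit is proper, the product of
  these two ideals contains \<open>a \<otimes> b\<close> and consists of its multiples
  (\<open>ideal_prod_cgenideal_subset\<close>), and every element of \<open>R m\<close> is mapped into \<open>N\<close> by \<open>a \<otimes> b\<close> as soon
  as \<open>m\<close> is (\<open>smult_cyclic_submodule\<close>).
\<close>

lemma ideal_prod_subsetI:
  assumes "\<And>a b. \<lbrakk>a \<in> I; b \<in> J\<rbrakk> \<Longrightarrow> a \<otimes>\<^bsub>R\<^esub> b \<in> H"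
    and "\<And>x y. \<lbrakk>x \<in> H; y \<in> H\<rbrakk> \<Longrightarrow> x \<oplus>\<^bsub>R\<^esub> y \<in> H"
  shows "ideal_prod R I J \<subseteq> H"
proof
  fix x assume "x \<in> ideal_prod R I J"
  then show "x \<in> H" by induction (auto intro: assms)
qed

lemma (in module) ideal_module_prod_subsetI:
  assumes "submodule N R M"
    and "\<And>i k. \<lbrakk>i \<in> I; k \<in> K\<rbrakk> \<Longrightarrow> i \<odot>\<^bsub>M\<^esub> k \<in> N"
  shows "ideal_module_prod M I K \<subseteq> N"
proof
  fix x assume "x \<in> ideal_module_prod M I K"
  then show "x \<in> N" by induction (auto intro: assms(2) submoduleE(5)[OF assms(1)])
qed

lemma (in module) module_colon_add_closed:
  assumes "submodule N R M" "x \<in> module_colon R M N" "y \<in> module_colon R M N"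
  shows "x \<oplus> y \<in> module_colon R M N"
  using assms(2,3) submoduleE(5)[OF assms(1)]
  by (auto simp: module_colon_def smult_l_distr)

lemma (in ring) proper_ideal_nonunit:
  assumes "ideal I R" "I \<noteq> carrier R" "a \<in> I"
  shows "a \<in> carrier R - Units R"
proof
  show "a \<in> carrier R" using assms(1,3) by (rule ideal.Icarr)
  show "a \<notin> Units R"
  proof
    assume "a \<in> Units R"
    then have "\<one> \<in> I"
      using ideal.I_r_closed[OF assms(1,3), of "inv a"] by simp
    then show False using ideal.one_imp_carrier[OF assms(1)] assms(2) by simp
  qed
qed

lemma (in cring) cgenideal_nonunit_proper:
  assumes "a \<in> carrier R - Units R"
  shows "PIdl a \<noteq> carrier R"
proof
  assume "PIdl a = carrier R"
  then obtain x where "x \<in> carrier R" "\<one> = x \<otimes> a"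
    unfolding cgenideal_def using one_closed by blast
  with assms show False
    unfolding Units_def using m_comm by force
qed

lemma (in cring) ideal_prod_cgenideal_subset:
  assumes "a \<in> carrier R" "b \<in> carrier R"
  shows "(PIdl a) \<cdot> (PIdl b) \<subseteq> PIdl (a \<otimes> b)"
proof (rule ideal_prod_subsetI)
  show "x \<otimes> y \<in> PIdl (a \<otimes> b)" if "x \<in> PIdl a" "y \<in> PIdl b" for x y
    using that unfolding cgenideal_prod[OF assms, symmetric] set_mult_def by blast
  show "x \<oplus> y \<in> PIdl (a \<otimes> b)" if "x \<in> PIdl (a \<otimes> b)" "y \<in> PIdl (a \<otimes> b)" for x y
    using that assms cgenideal_ideal[of "a \<otimes> b"]
    by (simp add: additive_subgroup.a_closed ideal.axioms(1))
qed

definition cyclic_submodule ::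
    "('a, 'r) ring_scheme \<Rightarrow> ('a, 'b, 'm) module_scheme \<Rightarrow> 'b \<Rightarrow> 'b set"
  where "cyclic_submodule R M m = (\<lambda>r. r \<odot>\<^bsub>M\<^esub> m) ` carrier R"

lemma (in module) cyclic_submodule_is_submodule:
  assumes m: "m \<in> carrier M"
  shows "submodule (cyclic_submodule R M m) R M"
proof (rule submoduleI)
  show "cyclic_submodule R M m \<subseteq> carrier M"
    using m by (auto simp: cyclic_submodule_def)
  show "\<zero>\<^bsub>M\<^esub> \<in> cyclic_submodule R M m"
    unfolding cyclic_submodule_def using m by (intro image_eqI[of _ _ "\<zero>"]) auto
next
  fix x assume "x \<in> cyclic_submodule R M m"
  then obtain r where r: "r \<in> carrier R" "x = r \<odot>\<^bsub>M\<^esub> m" by (auto simp: cyclic_submodule_def)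
  then show "\<ominus>\<^bsub>M\<^esub> x \<in> cyclic_submodule R M m"
    unfolding cyclic_submodule_def using m
    by (intro image_eqI[of _ _ "\<ominus> r"]) (auto simp: smult_l_minus)
next
  fix x y assume "x \<in> cyclic_submodule R M m" "y \<in> cyclic_submodule R M m"
  then obtain r s where rs: "r \<in> carrier R" "x = r \<odot>\<^bsub>M\<^esub> m" "s \<in> carrier R" "y = s \<odot>\<^bsub>M\<^esub> m"
    by (auto simp: cyclic_submodule_def)
  then show "x \<oplus>\<^bsub>M\<^esub> y \<in> cyclic_submodule R M m"
    unfolding cyclic_submodule_def using m
    by (intro image_eqI[of _ _ "r \<oplus> s"]) (auto simp: smult_l_distr)
next
  fix a x assume a: "a \<in> carrier R" and "x \<in> cyclic_submodule R M m"
  then obtain r where r: "r \<in> carrier R" "x = r \<odot>\<^bsub>M\<^esub> m" by (auto simp: cyclic_submodule_def)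
  then show "a \<odot>\<^bsub>M\<^esub> x \<in> cyclic_submodule R M m"
    unfolding cyclic_submodule_def using m a
    by (intro image_eqI[of _ _ "a \<otimes> r"]) (auto simp: smult_assoc1)
qed

lemma (in module) cyclic_submodule_self:
  assumes "m \<in> carrier M"
  shows "m \<in> cyclic_submodule R M m"
  unfolding cyclic_submodule_def using assms by (intro image_eqI[of _ _ "\<one>"]) auto

text \<open>
  By commutativity \<open>c (r m) = r (c m)\<close>, so a submodule containing \<open>c m\<close> contains \<open>c (R m)\<close>.
\<close>

lemma (in module) smult_cyclic_submodule:
  assumes "submodule N R M" "c \<in> carrier R" "m \<in> carrier M" "c \<odot>\<^bsub>M\<^esub> m \<in> N"
    and "k \<in> cyclic_submodule R M m"
  shows "c \<odot>\<^bsub>M\<^esub> k \<in> N"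
proof -
  from assms(5) obtain r where r: "r \<in> carrier R" "k = r \<odot>\<^bsub>M\<^esub> m"
    by (auto simp: cyclic_submodule_def)
  then have "c \<odot>\<^bsub>M\<^esub> k = r \<odot>\<^bsub>M\<^esub> (c \<odot>\<^bsub>M\<^esub> m)"
    using assms(2,3) by (metis smult_assoc1 m_comm)
  then show ?thesis using submoduleE(4)[OF assms(1) r(1) assms(4)] by simp
qed

theorem theorem1:
  fixes R :: "('a, 'r) ring_scheme" and M :: "('a, 'b, 'm) module_scheme" and N :: "'b set"
  assumes "module R M"
    and "\<one>\<^bsub>R\<^esub> \<noteq> \<zero>\<^bsub>R\<^esub>"
    and "proper_submodule R M N"
  shows
    "(one_absorbing_primary_submodule R M N \<longleftrightarrow>
        (\<forall>a \<in> carrier R - Units R. \<forall>b \<in> carrier R - Units R.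
           a \<otimes>\<^bsub>R\<^esub> b \<notin> module_colon R M N \<longrightarrow>
             element_colon M N (a \<otimes>\<^bsub>R\<^esub> b) \<subseteq> module_rad R M N)) \<and>
     (one_absorbing_primary_submodule R M N \<longleftrightarrow>
        (\<forall>a \<in> carrier R - Units R. \<forall>b \<in> carrier R - Units R. \<forall>K. submodule K R M \<longrightarrow>
           (\<lambda>k. (a \<otimes>\<^bsub>R\<^esub> b) \<odot>\<^bsub>M\<^esub> k) ` K \<subseteq> N \<longrightarrow>
             a \<otimes>\<^bsub>R\<^esub> b \<in> module_colon R M N \<or> K \<subseteq> module_rad R M N)) \<and>
     (one_absorbing_primary_submodule R M N \<longleftrightarrow>
        (\<forall>I\<^sub>1 I\<^sub>2 K. ideal I\<^sub>1 R \<and> I\<^sub>1 \<noteq> carrier R \<and> ideal I\<^sub>2 R \<and> I\<^sub>2 \<noteq> carrier R \<and> submodule K R M \<longrightarrow>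
           ideal_module_prod M (ideal_prod R I\<^sub>1 I\<^sub>2) K \<subseteq> N \<longrightarrow>
             ideal_prod R I\<^sub>1 I\<^sub>2 \<subseteq> module_colon R M N \<or> K \<subseteq> module_rad R M N))"
proof -
  interpret module R M by fact
  let ?Q = "module_rad R M N"
  let ?C = "module_colon R M N"
  let ?NU = "carrier R - Units R"
  let ?S1 = "\<forall>a \<in> ?NU. \<forall>b \<in> ?NU. \<forall>m \<in> carrier M.
    (a \<otimes>\<^bsub>R\<^esub> b) \<odot>\<^bsub>M\<^esub> m \<in> N \<longrightarrow> a \<otimes>\<^bsub>R\<^esub> b \<in> ?C \<or> m \<in> ?Q"
  let ?S2 = "\<forall>a \<in> ?NU. \<forall>b \<in> ?NU. a \<otimes>\<^bsub>R\<^esub> b \<notin> ?C \<longrightarrow> element_colon M N (a \<otimes>\<^bsub>R\<^esub> b) \<subseteq> ?Q"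
  let ?S3 = "\<forall>a \<in> ?NU. \<forall>b \<in> ?NU. \<forall>K. submodule K R M \<longrightarrow>
    (\<lambda>k. (a \<otimes>\<^bsub>R\<^esub> b) \<odot>\<^bsub>M\<^esub> k) ` K \<subseteq> N \<longrightarrow> a \<otimes>\<^bsub>R\<^esub> b \<in> ?C \<or> K \<subseteq> ?Q"
  let ?S4 = "\<forall>I\<^sub>1 I\<^sub>2 K. ideal I\<^sub>1 R \<and> I\<^sub>1 \<noteq> carrier R \<and> ideal I\<^sub>2 R \<and> I\<^sub>2 \<noteq> carrier R \<and> submodule K R M \<longrightarrow>
    ideal_module_prod M (ideal_prod R I\<^sub>1 I\<^sub>2) K \<subseteq> N \<longrightarrow> ideal_prod R I\<^sub>1 I\<^sub>2 \<subseteq> ?C \<or> K \<subseteq> ?Q"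
  have N: "submodule N R M" using assms(3) by (simp add: proper_submodule_def)
  have S1: "one_absorbing_primary_submodule R M N \<longleftrightarrow> ?S1"
    using assms(3) by (simp add: one_absorbing_primary_submodule_def)
  have S2: "?S1 \<longleftrightarrow> ?S2" unfolding element_colon_def by blast
  have S13: "?S3" if "?S1"
  proof (intro ballI allI impI)
    fix a b K
    assume ab: "a \<in> ?NU" "b \<in> ?NU" and K: "submodule K R M"
      and abK: "(\<lambda>k. (a \<otimes>\<^bsub>R\<^esub> b) \<odot>\<^bsub>M\<^esub> k) ` K \<subseteq> N"
    show "a \<otimes>\<^bsub>R\<^esub> b \<in> ?C \<or> K \<subseteq> ?Q"
      using that ab abK submoduleE(1)[OF K] by blast
  qed
  have S31: "?S1" if "?S3"
  proof (intro ballI impI)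
    fix a b m
    assume ab: "a \<in> ?NU" "b \<in> ?NU" and m: "m \<in> carrier M" and abm: "(a \<otimes>\<^bsub>R\<^esub> b) \<odot>\<^bsub>M\<^esub> m \<in> N"
    have "(\<lambda>k. (a \<otimes>\<^bsub>R\<^esub> b) \<odot>\<^bsub>M\<^esub> k) ` cyclic_submodule R M m \<subseteq> N"
      using smult_cyclic_submodule[OF N _ m abm] ab by blast
    then have "a \<otimes>\<^bsub>R\<^esub> b \<in> ?C \<or> cyclic_submodule R M m \<subseteq> ?Q"
      using that ab cyclic_submodule_is_submodule[OF m] by blast
    then show "a \<otimes>\<^bsub>R\<^esub> b \<in> ?C \<or> m \<in> ?Q"
      using cyclic_submodule_self[OF m] by blast
  qed
  have S14: "?S4" if S1: "?S1"
  proof (intro allI impI)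
    fix I J K
    assume "ideal I R \<and> I \<noteq> carrier R \<and> ideal J R \<and> J \<noteq> carrier R \<and> submodule K R M"
    then have I: "ideal I R" "I \<noteq> carrier R" and J: "ideal J R" "J \<noteq> carrier R"
      and K: "submodule K R M" by auto
    assume IJK: "ideal_module_prod M (ideal_prod R I J) K \<subseteq> N"
    show "ideal_prod R I J \<subseteq> ?C \<or> K \<subseteq> ?Q"
    proof (cases "ideal_prod R I J \<subseteq> ?C")
      case False
      then obtain a b where ab: "a \<in> I" "b \<in> J" "a \<otimes>\<^bsub>R\<^esub> b \<notin> ?C"
        using ideal_prod_subsetI[of I J R ?C] module_colon_add_closed[OF N] by blast
      have "k \<in> ?Q" if k: "k \<in> K" for k
      proof -
        have "(a \<otimes>\<^bsub>R\<^esub> b) \<odot>\<^bsub>M\<^esub> k \<in> N"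
          using IJK ab(1,2) k by (blast intro: ideal_module_prod.smult ideal_prod.prod)
        moreover have "a \<in> ?NU" "b \<in> ?NU"
          using proper_ideal_nonunit[OF I ab(1)] proper_ideal_nonunit[OF J ab(2)] by auto
        ultimately show ?thesis
          using S1 ab(3) submoduleE(1)[OF K] k by blast
      qed
      then show ?thesis by blast
    qed simp
  qed
  have S41: "?S1" if S4: "?S4"
  proof (intro ballI impI)
    fix a b m
    assume ab: "a \<in> ?NU" "b \<in> ?NU" and m: "m \<in> carrier M" and abm: "(a \<otimes>\<^bsub>R\<^esub> b) \<odot>\<^bsub>M\<^esub> m \<in> N"
    let ?I = "PIdl\<^bsub>R\<^esub> a" and ?J = "PIdl\<^bsub>R\<^esub> b" and ?K = "cyclic_submodule R M m"
    have carr: "a \<in> carrier R" "b \<in> carrier R" using ab by auto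
    have K: "submodule ?K R M" using m by (rule cyclic_submodule_is_submodule)
    have "ideal_module_prod M (ideal_prod R ?I ?J) ?K \<subseteq> N"
    proof (rule ideal_module_prod_subsetI[OF N])
      fix i k assume "i \<in> ideal_prod R ?I ?J" and k: "k \<in> ?K"
      then obtain r where r: "r \<in> carrier R" "i = r \<otimes>\<^bsub>R\<^esub> (a \<otimes>\<^bsub>R\<^esub> b)"
        using ideal_prod_cgenideal_subset[OF carr] unfolding cgenideal_def by blast
      have "k \<in> carrier M" using submoduleE(1)[OF K] k by blast
      then have "i \<odot>\<^bsub>M\<^esub> k = r \<odot>\<^bsub>M\<^esub> ((a \<otimes>\<^bsub>R\<^esub> b) \<odot>\<^bsub>M\<^esub> k)"
        using r carr by (simp add: smult_assoc1)
      moreover have "(a \<otimes>\<^bsub>R\<^esub> b) \<odot>\<^bsub>M\<^esub> k \<in> N"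
        using smult_cyclic_submodule[OF N _ m abm k] carr by simp
      ultimately show "i \<odot>\<^bsub>M\<^esub> k \<in> N"
        using submoduleE(4)[OF N r(1)] by simp
    qed
    then have "ideal_prod R ?I ?J \<subseteq> ?C \<or> ?K \<subseteq> ?Q"
      using S4 K cgenideal_ideal[OF carr(1)] cgenideal_ideal[OF carr(2)]
        cgenideal_nonunit_proper[OF ab(1)] cgenideal_nonunit_proper[OF ab(2)] by blast
    moreover have "a \<otimes>\<^bsub>R\<^esub> b \<in> ideal_prod R ?I ?J"
      using carr by (intro ideal_prod.prod cgenideal_self)
    ultimately show "a \<otimes>\<^bsub>R\<^esub> b \<in> ?C \<or> m \<in> ?Q"
      using cyclic_submodule_self[OF m] by blast
  qed
  have S3: "?S1 \<longleftrightarrow> ?S3" using S13 S31 by (rule iffI)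
  have S4: "?S1 \<longleftrightarrow> ?S4" using S14 S41 by (rule iffI)
  show ?thesis unfolding S1 by (intro conjI S2 S3 S4)
qed

end
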